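(* (i) For every integer $k\ge0$, the set $\mathrm{Ulam}[2^{k+1}-1]$ consists of exactly those $(x,z)\in\mathbb{N}^2$ such that $x+z\equiv-1\pmod{2^{k+1}}$ and $x+z\ne2^{k+1}-1$. (ii) For every integer $k\ge1$, the set $\mathrm{Ulam}[2^{k+1}-2]$ consists of exactly those $(x,z)\in\mathbb{N}^2$ such that at least one of the following holds: - $x+z\equiv-1\pmod{2^{k+1}}$ and $x+z\neq2^{k+1}-1$; - $x+z=2^{k+1}-2$ and $x,z\equiv0\pmod2$; - $x+z=2^{k+1}$ and $x,z>0$. (iii) Let $y=2^{k+1}-2^a-1$ for some integers $0<a<k$ (so that $y$ is a Zumkeller number). Then $\mathrm{Ulam}[y]$ is the set of exactly those $(x,z)\in\mathbb{N}^2$ such that at least one of the following holds: - $x+z=y$ and $(x \bmod 2^{a+1})<2^a$; - $x+z\equiv-1\pmod{2^{k+1}}$; - $(x\bmod 2^{k+1})+(z\bmod 2^{k+1})=2^{k+1}+2^a-1$.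
   Context: $\mathbb{N}=\{0,1,2,\dots\}$; $n\bmod m$ denotes the residue of $n$ in $\{0,\dots,m-1\}$. Ulam words are binary words defined recursively: $\mathcal{U}(1)=\{0,1\}$, and for $n>1$, $\mathcal{U}(n)$ is the set of all words of length $n$ over $\{0,1\}$ that are expressible uniquely as a concatenation $uv$ of two distinct words $u\in\mathcal{U}(i)$, $v\in\mathcal{U}(j)$ with $i,j<n$ (i.e. there is exactly one ordered pair $(u,v)$ of such words, $u\ne v$). A word is Ulam if it belongs to $\bigcup_{n\ge1}\mathcal{U}(n)$. $0^m$ denotes a block of $m$ zeros. $\mathrm{Ulam}[y]\subset\mathbb{N}^2$ is the set of $(x,z)$ such that the word $0^x10^y10^z$ is Ulam. A positive integer is a Zumkeller number if it has at most one $0$ in its binary representation. *)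

theory Defs
  imports Main "HOL-Number_Theory.Cong"
begin

text \<open>Binary words are lists of type \<^typ>\<open>bool list\<close>, with False as the letter 0 and True as
  the letter 1. The set for length 0 is empty, so the empty word is not Ulam and takes part in
  no decomposition.\<close>

function ulam_words :: "nat \<Rightarrow> bool list set" where
  "ulam_words n =
    (if n = 0 then {}
     else if n = 1 then {[False], [True]}
     else {w. length w = n \<and>
            (\<exists>!p. fst p \<noteq> snd p \<and> w = fst p @ snd p \<and>
              (\<exists>i\<in>{1..<n}. \<exists>j\<in>{1..<n}. fst p \<in> ulam_words i \<and> snd p \<in> ulam_words j))})"
  by pat_completeness auto
termination
  by (relation "Wellfounded.measure id") auto

declare ulam_words.simps [simp del]

definition is_ulam :: "bool list \<Rightarrow> bool" where
  "is_ulam w \<longleftrightarrow> w \<in> (\<Union>n\<in>{1..}. ulam_words n)"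

definition Ulam :: "nat \<Rightarrow> (nat \<times> nat) set" where
  "Ulam y = {(x, z). is_ulam
     (replicate x False @ [True] @ replicate y False @ [True] @ replicate z False)}"

text \<open>The binary representation of a positive n has no leading zeros: its digit positions are
  exactly the i with \<open>2 ^ i \<le> n\<close>.\<close>

definition zumkeller :: "nat \<Rightarrow> bool" where
  "zumkeller n \<longleftrightarrow> n > 0 \<and> card {i. 2 ^ i \<le> n \<and> \<not> bit n i} \<le> 1"

end

theory Submission
  imports Defs
begin

text \<open>Cutting off a letter shows, via Pascal's triangle mod 2, that \<open>0\<^sup>x10\<^sup>z\<close> is Ulam iff \<open>x\<close> and \<open>z\<close>
  have disjoint binary supports. A decomposition of \<open>0\<^sup>x10\<^sup>y10\<^sup>z\<close> removes an outer zero or cuts between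
  the two ones, so membership of \<open>(x, z)\<close> in \<open>Ulam[y]\<close> is determined by \<open>(x - 1, z)\<close>, \<open>(x, z - 1)\<close> and
  the number of \<open>i \<le> y\<close> with \<open>i\<close> disjoint from \<open>x\<close> and \<open>y - i\<close> disjoint from \<open>z\<close>. That number obeys a
  recurrence on the lowest binary digit, which for Zumkeller \<open>y\<close> decides when it is 1. It then suffices
  to see that the claimed set obeys the same recurrence on \<open>x + z\<close>.\<close>

subsection \<open>Decompositions of words with one or two ones\<close>

text \<open>A block of two zeros splits only into equal halves, so no longer block of zeros is Ulam
  and an outer cut removes exactly one zero. In all three answers a member \<open>(x, z)\<close> has
  no neighbour in the set and exactly one admissible middle cut. The work lies with the nonmembers,
  whose total must miss 1: two neighbours in the set already give 2, while a single neighbour has to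
  be accompanied by a positive count, which is what \<open>middle_count_pos\<close> is for. The cut
  into equal halves affects only the row \<open>x + z = y\<close>; the isolated rows in the answers
  are its consequences. Zumkeller numbers are tractable because a digit 1 of \<open>y\<close> merely
  multiplies the count by 0, 1 or 2, whereas a digit 0 adds a second count with a borrow. With a
  single zero digit the borrow leads from \<open>2 ^ k - 1\<close> to \<open>2 ^ k - 2\<close> and
  so never leaves these two families.\<close>

definition splits :: "bool list \<Rightarrow> nat set" where
  "splits w = {i. i \<le> length w \<and> take i w \<noteq> drop i w \<and> is_ulam (take i w) \<and> is_ulam (drop i w)}"

lemma length_ulam_words: "w \<in> ulam_words n \<Longrightarrow> length w = n"
  by (subst (asm) ulam_words.simps) (auto split: if_splits)

lemma ulam_words_eq: "ulam_words n = {w. length w = n \<and> is_ulam w}"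
proof -
  have "n \<noteq> 0" if "w \<in> ulam_words n" for w
    using that by (subst (asm) ulam_words.simps) (auto split: if_splits)
  then show ?thesis
    unfolding is_ulam_def using length_ulam_words by fastforce
qed

lemma not_is_ulam_Nil [simp]: "\<not> is_ulam []"
  using length_ulam_words by (fastforce simp: is_ulam_def)

lemma Ex1_iff_card: "(\<exists>!x. P x) \<longleftrightarrow> card {x. P x} = 1"
proof -
  have "(\<exists>!x. P x) \<longleftrightarrow> (\<exists>x. {x. P x} = {x})"
    unfolding Ex1_def by blast
  then show ?thesis by (simp add: card_1_singleton_iff)
qed

text \<open>The cut position determines the pair, so unique decomposability becomes a cardinality.
  The length bounds in \<open>ulam_words\<close> only say that both factors are nonempty, which
  \<open>not_is_ulam_Nil\<close> supplies.\<close>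

lemma is_ulam_iff: "is_ulam w \<longleftrightarrow> length w = 1 \<or> card (splits w) = 1"
proof -
  let ?n = "length w"
  let ?Q = "\<lambda>p. fst p \<noteq> snd p \<and> w = fst p @ snd p \<and> is_ulam (fst p) \<and> is_ulam (snd p)"
  let ?R = "\<lambda>p. fst p \<noteq> snd p \<and> w = fst p @ snd p \<and>
              (\<exists>i\<in>{1..<?n}. \<exists>j\<in>{1..<?n}. fst p \<in> ulam_words i \<and> snd p \<in> ulam_words j)"
  have R: "?R p \<longleftrightarrow> ?Q p" for p
  proof
    assume "?Q p"
    then have "fst p \<noteq> []" "snd p \<noteq> []"
      by auto
    then have "0 < length (fst p)" "0 < length (snd p)" by auto
    with \<open>?Q p\<close> show "?R p"
      by (auto simp: ulam_words_eq Suc_le_eq)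
  qed (auto simp: ulam_words_eq)
  have splits_image: "{p. ?Q p} = (\<lambda>i. (take i w, drop i w)) ` splits w"
  proof (intro set_eqI iffI)
    fix p assume "p \<in> {p. ?Q p}"
    then have "length (fst p) \<in> splits w"
      and "p = (take (length (fst p)) w, drop (length (fst p)) w)"
      by (auto simp: splits_def prod_eq_iff)
    then show "p \<in> (\<lambda>i. (take i w, drop i w)) ` splits w" by blast
  qed (auto simp: splits_def)
  have "inj_on (\<lambda>i. (take i w, drop i w)) (splits w)"
    by (rule inj_on_inverseI[where g = "\<lambda>p. length (fst p)"]) (auto simp: splits_def)
  then have "card {p. ?Q p} = card (splits w)"
    by (simp add: splits_image card_image)
  then have ex1: "(\<exists>!p. ?Q p) \<longleftrightarrow> card (splits w) = 1"
    by (simp only: Ex1_iff_card)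
  have empty: "splits w = {}" if "?n \<le> 1"
  proof -
    have False if i: "i \<in> splits w" for i
    proof -
      have "take i w = [] \<or> drop i w = []"
        using \<open>?n \<le> 1\<close> by (cases i) auto
      with i show False
        by (auto simp: splits_def simp del: take_eq_Nil drop_eq_Nil)
    qed
    then show ?thesis by blast
  qed
  have "is_ulam w \<longleftrightarrow> w \<in> ulam_words ?n"
    by (simp add: ulam_words_eq)
  also have "\<dots> \<longleftrightarrow> ?n = 1 \<or> ?n > 1 \<and> (\<exists>!p. ?Q p)"
  proof -
    have "w \<in> {[False], [True]}" if "?n = 1"
      using that by (cases w) auto
    moreover have "ulam_words ?n = {w'. length w' = ?n \<and>
        (\<exists>!p. fst p \<noteq> snd p \<and> w' = fst p @ snd p \<and>
        (\<exists>i\<in>{1..<?n}. \<exists>j\<in>{1..<?n}. fst p \<in> ulam_words i \<and> snd p \<in> ulam_words j))}"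
      if "?n > 1"
      using that by (subst ulam_words.simps) auto
    moreover have "ulam_words 0 = {}" "ulam_words 1 = {[False], [True]}"
      by (subst ulam_words.simps, simp)+
    moreover have "?n = 0 \<or> ?n = 1 \<or> ?n > 1" by linarith
    ultimately show ?thesis
      unfolding R[symmetric] by (elim disjE) (simp_all del: One_nat_def)
  qed
  also have "\<dots> \<longleftrightarrow> ?n = 1 \<or> card (splits w) = 1"
    unfolding ex1 using empty by (cases "?n \<le> 1") auto
  finally show ?thesis .
qed

lemma is_ulam_zeros: "is_ulam (replicate n False) \<longleftrightarrow> n = 1"
proof (induction n rule: less_induct)
  case (less n)
  have "splits (replicate n False) = {}"
  proof -
    have False if "i \<in> splits (replicate n False)" for i
    proof -
      have i: "i \<le> n" "is_ulam (replicate i False)" "is_ulam (replicate (n - i) False)" "i \<noteq> n - i"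
        using that by (auto simp: splits_def min_def)
      then have "i \<noteq> 0" "n - i \<noteq> 0"
        by (metis not_is_ulam_Nil replicate_0)+
      with i less.IH[of i] less.IH[of "n - i"] show False by simp
    qed
    then show ?thesis by blast
  qed
  then show ?case by (simp add: is_ulam_iff)
qed

definition one_word :: "nat \<Rightarrow> nat \<Rightarrow> bool list" where
  "one_word x z = replicate x False @ True # replicate z False"

definition two_word :: "nat \<Rightarrow> nat \<Rightarrow> nat \<Rightarrow> bool list" where
  "two_word x y z = replicate x False @ True # replicate y False @ True # replicate z False"

lemma length_one_word [simp]: "length (one_word x z) = x + z + 1"
  by (simp add: one_word_def)

lemma length_two_word [simp]: "length (two_word x y z) = x + y + z + 2"
  by (simp add: two_word_def)

lemma take_drop_one_word:
  "i \<le> x \<Longrightarrow> take i (one_word x z) = replicate i False"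
  "i \<le> x \<Longrightarrow> drop i (one_word x z) = one_word (x - i) z"
  "i \<le> z \<Longrightarrow> take (x + 1 + i) (one_word x z) = one_word x i"
  "i \<le> z \<Longrightarrow> drop (x + 1 + i) (one_word x z) = replicate (z - i) False"
  by (auto simp: one_word_def min_def)

lemma take_drop_two_word:
  "i \<le> x \<Longrightarrow> take i (two_word x y z) = replicate i False"
  "i \<le> x \<Longrightarrow> drop i (two_word x y z) = two_word (x - i) y z"
  "i \<le> y \<Longrightarrow> take (x + 1 + i) (two_word x y z) = one_word x i"
  "i \<le> y \<Longrightarrow> drop (x + 1 + i) (two_word x y z) = one_word (y - i) z"
  "i \<le> z \<Longrightarrow> take (x + y + 2 + i) (two_word x y z) = two_word x y i"
  "i \<le> z \<Longrightarrow> drop (x + y + 2 + i) (two_word x y z) = replicate (z - i) False"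
  by (auto simp: one_word_def two_word_def min_def)

text \<open>The number of ones tells the kinds of words apart, so the two halves of a cut at an
  outer zero are automatically distinct.\<close>

lemma count_word [simp]:
  "count_list (one_word x z) True = 1" "count_list (two_word x y z) True = 2"
  "count_list (replicate n False) True = 0"
proof -
  show zeros: "count_list (replicate n False) True = 0" for n
    by (simp add: count_list_0_iff)
  show "count_list (one_word x z) True = 1" "count_list (two_word x y z) True = 2"
    by (simp_all add: one_word_def two_word_def zeros)
qed

lemma word_neq [simp]:
  "replicate n False \<noteq> one_word x z" "one_word x z \<noteq> replicate n False"
  "replicate n False \<noteq> two_word x y z" "two_word x y z \<noteq> replicate n False"
  by (metis count_word zero_neq_one zero_neq_numeral)+

lemma singleton_neq_word [simp]:
  "[False] \<noteq> one_word x z" "one_word x z \<noteq> [False]"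
  "[False] \<noteq> two_word x y z" "two_word x y z \<noteq> [False]"
  using word_neq[of 1] word_neq(2)[of x z 1] word_neq(4)[of x y z 1] by simp_all

lemma is_ulam_singleton_False [simp]: "is_ulam [False]"
  using is_ulam_zeros[of 1] by simp

lemma one_word_eq_iff: "one_word x z = one_word x' z' \<longleftrightarrow> x = x' \<and> z = z'"
proof
  assume eq: "one_word x z = one_word x' z'"
  have "takeWhile Not (one_word x z) = replicate x False" for x z
    by (simp add: one_word_def takeWhile_append)
  with eq have "x = x'" by (metis length_replicate)
  with eq show "x = x' \<and> z = z'" using length_one_word[of x z] by simp
qed auto

text \<open>Every cut splits off a pure block of zeros, which must have length 1.\<close>

lemma splits_one_word:
  "splits (one_word x z) =
     (if x > 0 \<and> is_ulam (one_word (x - 1) z) then {1} else {}) \<union>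
     (if z > 0 \<and> is_ulam (one_word x (z - 1)) then {x + z} else {})" (is "_ = ?A")
proof (intro set_eqI)
  fix i
  consider "i \<le> x" | j where "j \<le> z" "i = x + 1 + j" | "i > x + z + 1"
  proof -
    have "i \<le> x \<or> (i - (x + 1) \<le> z \<and> i = x + 1 + (i - (x + 1))) \<or> i > x + z + 1"
      by linarith
    then show ?thesis using that by blast
  qed
  then show "i \<in> splits (one_word x z) \<longleftrightarrow> i \<in> ?A"
  proof cases
    case 1
    then show ?thesis
      by (auto simp: splits_def take_drop_one_word is_ulam_zeros)
  next
    case 2
    then show ?thesis
      using take_drop_one_word(3,4)[OF 2(1), of x]
      by (cases "z = j + 1") (auto simp: splits_def is_ulam_zeros)
  next
    case 3
    then show ?thesis
      by (auto simp: splits_def)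
  qed
qed

text \<open>Only for a cut between the ones is distinctness a genuine condition: the halves
  \<open>one_word x i\<close> and \<open>one_word (y - i) z\<close> may coincide.\<close>

lemma splits_two_word:
  "splits (two_word x y z) =
     (if x > 0 \<and> is_ulam (two_word (x - 1) y z) then {1} else {}) \<union>
     ((+) (x + 1)) ` {i. i \<le> y \<and> is_ulam (one_word x i) \<and> is_ulam (one_word (y - i) z) \<and>
        \<not> (x = y - i \<and> i = z)} \<union>
     (if z > 0 \<and> is_ulam (two_word x y (z - 1)) then {x + y + z + 1} else {})" (is "_ = ?L \<union> (+) (x + 1) ` ?B \<union> ?R")
proof (intro set_eqI)
  fix i
  consider "i \<le> x" | j where "j \<le> y" "i = x + 1 + j" | j where "j \<le> z" "i = x + y + 2 + j"
    | "i > x + y + z + 2"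
  proof -
    have "i \<le> x \<or> (i - (x + 1) \<le> y \<and> i = x + 1 + (i - (x + 1))) \<or>
      (i - (x + y + 2) \<le> z \<and> i = x + y + 2 + (i - (x + y + 2))) \<or> i > x + y + z + 2"
      by linarith
    then show ?thesis using that by blast
  qed
  then show "i \<in> splits (two_word x y z) \<longleftrightarrow> i \<in> ?L \<union> (+) (x + 1) ` ?B \<union> ?R"
  proof cases
    case 1
    then show ?thesis
      by (auto simp: splits_def take_drop_two_word is_ulam_zeros)
  next
    case 2
    have "i \<in> splits (two_word x y z) \<longleftrightarrow> j \<in> ?B"
      unfolding splits_def mem_Collect_eq 2(2) take_drop_two_word(3,4)[OF 2(1)] one_word_eq_iff
      using 2(1) by auto
    moreover have "i \<in> (+) (x + 1) ` ?B \<longleftrightarrow> j \<in> ?B"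
      unfolding 2(2) by (rule inj_image_mem_iff) (auto intro: injI)
    moreover have "x > 0 \<Longrightarrow> i \<noteq> 1" "z > 0 \<Longrightarrow> i \<noteq> x + y + z + 1"
      using 2 by simp_all
    ultimately show ?thesis by auto
  next
    case 3
    have "i \<in> splits (two_word x y z) \<longleftrightarrow> is_ulam (two_word x y j) \<and> z = j + 1"
      unfolding splits_def mem_Collect_eq 3(2) take_drop_two_word(5,6)[OF 3(1)] is_ulam_zeros
      using 3(1) by auto
    moreover have "i \<notin> (+) (x + 1) ` ?B" "i \<noteq> 1" "i = x + y + z + 1 \<longleftrightarrow> z = j + 1"
      using 3 by auto
    ultimately show ?thesis by auto
  next
    case 4
    then show ?thesis
      by (auto simp: splits_def)
  qed
qed

section \<open>Disjoint binary supports and Pascal's triangle mod 2\<close>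

lemma and_eq_0_rec:
  fixes x z :: nat
  shows "and x z = 0 \<longleftrightarrow> (even x \<or> even z) \<and> and (x div 2) (z div 2) = 0"
  by (subst and_nat_rec) (auto simp: mod_2_eq_odd)

text \<open>By Kummer, \<open>and x z = 0\<close> says that the binomial coefficient of
  \<open>x + z\<close> over \<open>x\<close> is odd; this is Pascal's rule mod 2.\<close>

lemma and_eq_0_pascal:
  fixes x z :: nat
  assumes "x > 0" "z > 0"
  shows "and x z = 0 \<longleftrightarrow> (and (x - 1) z = 0) \<noteq> (and x (z - 1) = 0)"
  using assms
proof (induction x arbitrary: z rule: less_induct)
  case (less x)
  note rec = and_eq_0_rec[of x z] and_eq_0_rec[of "x - 1" z] and_eq_0_rec[of x "z - 1"]
  show ?case
  proof (cases "even x \<and> even z")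
    case True
    \<comment> \<open>Both predecessors are odd, so the last digits never clash, and halving gives
      the same claim for \<open>p\<close> and \<open>q\<close>. In the other cases the three
      conditions have the same halves.\<close>
    then obtain p q where "x = 2 * p" "z = 2 * q" by (auto elim!: evenE)
    with less.prems have "(x - 1) div 2 = p - 1" "(z - 1) div 2 = q - 1" by linarith+
    with less.IH[of p q] less.prems \<open>x = 2 * p\<close> \<open>z = 2 * q\<close> rec show ?thesis by auto
  next
    case False
    then show ?thesis
      using rec less.prems by (cases "even x"; cases "even z"; elim oddE evenE) auto
  qed
qed

text \<open>For \<open>x, z > 0\<close> the two possible cut positions differ, so exactly one
  neighbour must be Ulam: the exclusive or of \<open>and_eq_0_pascal\<close>. On the border there is
  one neighbour, and it is Ulam.\<close>

lemma is_ulam_one_word: "is_ulam (one_word x z) \<longleftrightarrow> and x z = 0"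
proof (induction "x + z" arbitrary: x z rule: less_induct)
  case less
  have IH: "x > 0 \<Longrightarrow> is_ulam (one_word (x - 1) z) \<longleftrightarrow> and (x - 1) z = 0"
    "z > 0 \<Longrightarrow> is_ulam (one_word x (z - 1)) \<longleftrightarrow> and x (z - 1) = 0"
    using less[of "x - 1" z] less[of x "z - 1"] by auto
  have ulam: "is_ulam (one_word x z) \<longleftrightarrow> x + z = 0 \<or> card (
     (if x > 0 \<and> and (x - 1) z = 0 then {1} else {}) \<union>
     (if z > 0 \<and> and x (z - 1) = 0 then {x + z} else {})) = 1"
    unfolding is_ulam_iff[of "one_word x z"] splits_one_word using IH by (simp cong: conj_cong)
  consider "x = 0" | "z = 0" "x > 0" | "x > 0" "z > 0" by auto
  then show ?case
  proof cases
    case 3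
    with and_eq_0_pascal[OF 3] show ?thesis
      unfolding ulam by auto
  next
    case 1
    then show ?thesis unfolding ulam by auto
  next
    case 2
    then show ?thesis unfolding ulam by auto
  qed
qed

text \<open>A cut between the two ones into equal halves is included here; it exists iff \<open>x + z = y\<close> and the
  supports of \<open>x\<close> and \<open>z\<close> are disjoint, and is subtracted in \<open>mem_Ulam_iff\<close>.\<close>

definition middle_count :: "nat \<Rightarrow> nat \<Rightarrow> nat \<Rightarrow> nat" where
  "middle_count y x z = card {i. i \<le> y \<and> and x i = 0 \<and> and (y - i) z = 0}"

section \<open>The recurrence on \<open>x + z\<close>\<close>

lemma card_shifted_union:
  fixes A B C :: "nat set"
  assumes A: "A \<subseteq> {..x}" and B: "B \<subseteq> {..y}" and C: "C \<subseteq> {x + y + 1<..}" "finite C"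
  shows "card (A \<union> (+) (x + 1) ` B \<union> C) = card A + card B + card C"
proof -
  let ?D = "(+) (x + 1) ` B"
  have D: "?D \<subseteq> {x + 1..x + y + 1}"
    using B by auto
  then have fin: "finite A" "finite ?D"
    using A by (meson finite_atMost finite_atLeastAtMost finite_subset)+
  have "A \<inter> ?D \<subseteq> {..x} \<inter> {x + 1..x + y + 1}" "(A \<union> ?D) \<inter> C \<subseteq> {..x + y + 1} \<inter> {x + y + 1<..}"
    using A C D by fastforce+
  moreover have "{..x} \<inter> {x + 1..x + y + 1} = {}" "{..x + y + 1} \<inter> {x + y + 1<..} = {}"
    by auto
  ultimately have "A \<inter> ?D = {}" "(A \<union> ?D) \<inter> C = {}"
    by (simp_all only: subset_empty)
  then show ?thesis
    using fin C by (simp only: card_Un_disjoint finite_UnI card_image[OF inj_on_add])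
qed

text \<open>The summands count the cuts after a leading zero, before a trailing zero and between the
  ones. The subtraction never truncates, since the cut \<open>i = z\<close> into equal halves is
  among those counted.\<close>

lemma mem_Ulam_iff:
  "(x, z) \<in> Ulam y \<longleftrightarrow>
     of_bool (x > 0 \<and> (x - 1, z) \<in> Ulam y) + of_bool (z > 0 \<and> (x, z - 1) \<in> Ulam y) +
     (middle_count y x z - of_bool (x + z = y \<and> and x z = 0)) = (1 :: nat)"
proof -
  have Ulam: "(x, z) \<in> Ulam y \<longleftrightarrow> is_ulam (two_word x y z)" for x z
    by (simp add: Ulam_def two_word_def)
  let ?A = "if x > 0 \<and> (x - 1, z) \<in> Ulam y then {1::nat} else {}"
  let ?B = "{i. i \<le> y \<and> and x i = 0 \<and> and (y - i) z = 0} - (if x + z = y \<and> and x z = 0 then {z} else {})"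
  let ?C = "if z > 0 \<and> (x, z - 1) \<in> Ulam y then {x + y + z + 1} else {}"
  have "{i. i \<le> y \<and> is_ulam (one_word x i) \<and> is_ulam (one_word (y - i) z) \<and>
        \<not> (x = y - i \<and> i = z)} = ?B"
    by (auto simp: is_ulam_one_word)
  then have "splits (two_word x y z) = ?A \<union> ((+) (x + 1)) ` ?B \<union> ?C"
    unfolding splits_two_word Ulam by simp
  moreover have "card (?A \<union> ((+) (x + 1)) ` ?B \<union> ?C) = card ?A + card ?B + card ?C"
    by (rule card_shifted_union[where y = y]) auto
  moreover have "card ?B = middle_count y x z - of_bool (x + z = y \<and> and x z = 0)"
  proof (cases "x + z = y \<and> and x z = 0")
    case True
    then have "z \<in> {i. i \<le> y \<and> and x i = 0 \<and> and (y - i) z = 0}" by auto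
    then have "card ({i. i \<le> y \<and> and x i = 0 \<and> and (y - i) z = 0} - {z}) = middle_count y x z - 1"
      unfolding middle_count_def by (simp only: card_Diff_singleton)
    with True show ?thesis by simp
  next
    case False
    then show ?thesis
      unfolding middle_count_def by (simp only: if_False of_bool_eq Diff_empty minus_nat.diff_0)
  qed
  ultimately have card: "card (splits (two_word x y z)) = card ?A +
      (middle_count y x z - of_bool (x + z = y \<and> and x z = 0)) + card ?C"
    by (simp only:)
  show ?thesis
    unfolding Ulam[of x z] is_ulam_iff[of "two_word x y z"] card by (auto simp: of_bool_def)
qed

text \<open>The recurrence refers only to pairs with a smaller sum and hence has a single
  solution.\<close>

lemma Ulam_eqI:
  assumes "\<And>x z. (x, z) \<in> S \<longleftrightarrow>
     of_bool (x > 0 \<and> (x - 1, z) \<in> S) + of_bool (z > 0 \<and> (x, z - 1) \<in> S) +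
     (middle_count y x z - of_bool (x + z = y \<and> and x z = 0)) = (1 :: nat)"
  shows "Ulam y = S"
proof -
  have "(x, z) \<in> Ulam y \<longleftrightarrow> (x, z) \<in> S" for x z
  proof (induction "x + z" arbitrary: x z rule: less_induct)
    case less
    have "x > 0 \<and> (x - 1, z) \<in> Ulam y \<longleftrightarrow> x > 0 \<and> (x - 1, z) \<in> S"
      "z > 0 \<and> (x, z - 1) \<in> Ulam y \<longleftrightarrow> z > 0 \<and> (x, z - 1) \<in> S"
      using less[of "x - 1" z] less[of x "z - 1"] by auto
    then show ?case
      unfolding mem_Ulam_iff[of x z y] assms[of x z] by presburger
  qed
  then show ?thesis by auto
qed

subsection \<open>Counting the cuts between the two ones\<close>

lemma and_double_eq_0:
  fixes x z :: nat
  shows "and x (2 * z) = 0 \<longleftrightarrow> and (x div 2) z = 0"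
    and "and (2 * x) z = 0 \<longleftrightarrow> and x (z div 2) = 0"
    and "and x (2 * z + 1) = 0 \<longleftrightarrow> even x \<and> and (x div 2) z = 0"
    and "and (2 * x + 1) z = 0 \<longleftrightarrow> even z \<and> and x (z div 2) = 0"
  by (subst and_eq_0_rec; simp)+

lemma card_eq_card_even_plus_card_odd:
  fixes S :: "nat set"
  assumes "finite S"
  shows "card S = card {j. 2 * j \<in> S} + card {j. 2 * j + 1 \<in> S}"
proof -
  let ?A = "(\<lambda>j. 2 * j) ` {j. 2 * j \<in> S}" and ?B = "(\<lambda>j. 2 * j + 1) ` {j. 2 * j + 1 \<in> S}"
  have "S = ?A \<union> ?B"
  proof (intro set_eqI iffI)
    fix i assume "i \<in> S"
    then show "i \<in> ?A \<union> ?B"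
      by (cases "even i") (auto elim!: evenE oddE)
  qed auto
  moreover have "?A \<inter> ?B = {}"
    by (auto simp: image_iff) presburger
  moreover have "inj_on (\<lambda>j::nat. 2 * j) X" "inj_on (\<lambda>j::nat. 2 * j + 1) X" for X
    by (simp_all add: inj_on_def)
  ultimately show ?thesis
    using assms by (metis card_Un_disjoint card_image finite_UnI finite_Un)
qed

text \<open>The last digits of \<open>i\<close> and \<open>2 * y + 1 - i\<close> are opposite: an
  even \<open>i\<close> asks for even \<open>z\<close>, an odd \<open>i\<close> for even
  \<open>x\<close>. Nothing is borrowed, so both leave the same condition on the halves.\<close>

lemma middle_count_odd:
  "middle_count (2 * y + 1) x z =
    (of_bool (even x) + of_bool (even z)) * middle_count y (x div 2) (z div 2)"
proof -
  define S where "S = {i. i \<le> 2 * y + 1 \<and> and x i = 0 \<and> and (2 * y + 1 - i) z = 0}"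
  define T where "T = {i. i \<le> y \<and> and (x div 2) i = 0 \<and> and (y - i) (z div 2) = 0}"
  have "2 * j \<in> S \<longleftrightarrow> even z \<and> j \<in> T" for j
  proof (cases "j \<le> y")
    case True
    then have "2 * y + 1 - 2 * j = 2 * (y - j) + 1" by simp
    then show ?thesis
      using True unfolding S_def T_def mem_Collect_eq by (simp only: and_double_eq_0) auto
  qed (auto simp: S_def T_def)
  moreover have "2 * j + 1 \<in> S \<longleftrightarrow> even x \<and> j \<in> T" for j
  proof (cases "j \<le> y")
    case True
    then have "2 * y + 1 - (2 * j + 1) = 2 * (y - j)" by simp
    then show ?thesis
      using True unfolding S_def T_def mem_Collect_eq by (simp only: and_double_eq_0) auto
  qed (auto simp: S_def T_def)
  ultimately have "{j. 2 * j \<in> S} = (if even z then T else {})"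
    "{j. 2 * j + 1 \<in> S} = (if even x then T else {})"
    by auto
  moreover have "finite S" by (simp add: S_def)
  ultimately have "card S = (of_bool (even x) + of_bool (even z)) * card T"
    by (simp add: card_eq_card_even_plus_card_odd)
  then show ?thesis
    by (simp add: middle_count_def S_def T_def)
qed

text \<open>Here \<open>i\<close> and \<open>2 * y - i\<close> have equal last digits. An even
  \<open>i\<close> imposes nothing on them; an odd \<open>i\<close> needs \<open>x\<close> and
  \<open>z\<close> even and borrows, hence \<open>y - 1\<close>.\<close>

lemma middle_count_even:
  "middle_count (2 * y) x z = middle_count y (x div 2) (z div 2) +
    (if even x \<and> even z \<and> y > 0 then middle_count (y - 1) (x div 2) (z div 2) else 0)"
proof -
  define S where "S = {i. i \<le> 2 * y \<and> and x i = 0 \<and> and (2 * y - i) z = 0}"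
  define T where "T y = {i. i \<le> y \<and> and (x div 2) i = 0 \<and> and (y - i) (z div 2) = 0}" for y
  have "2 * j \<in> S \<longleftrightarrow> j \<in> T y" for j
  proof (cases "j \<le> y")
    case True
    then have "2 * y - 2 * j = 2 * (y - j)" by simp
    then show ?thesis
      using True unfolding S_def T_def mem_Collect_eq by (simp only: and_double_eq_0) auto
  qed (auto simp: S_def T_def)
  moreover have "2 * j + 1 \<in> S \<longleftrightarrow> (even x \<and> even z \<and> y > 0) \<and> j \<in> T (y - 1)" for j
  proof (cases "j < y")
    case True
    then have "2 * y - (2 * j + 1) = 2 * (y - 1 - j) + 1" by simp
    then show ?thesis
      using True unfolding S_def T_def mem_Collect_eq by (simp only: and_double_eq_0) auto
  qed (auto simp: S_def T_def)
  ultimately have "{j. 2 * j \<in> S} = T y"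
    "{j. 2 * j + 1 \<in> S} = (if even x \<and> even z \<and> y > 0 then T (y - 1) else {})"
    by auto
  moreover have "finite S" by (simp add: S_def)
  ultimately have "card S = card (T y) + (if even x \<and> even z \<and> y > 0 then card (T (y - 1)) else 0)"
    by (simp add: card_eq_card_even_plus_card_odd)
  then show ?thesis
    by (simp add: middle_count_def S_def T_def)
qed

lemma middle_count_0 [simp]: "middle_count 0 x z = 1"
proof -
  have "{i. i \<le> (0::nat) \<and> and x i = 0 \<and> and (0 - i) z = 0} = {0}" by auto
  then show ?thesis by (simp add: middle_count_def)
qed

text \<open>The witnesses are the extreme cuts \<open>i = y\<close> and
  \<open>i = 0\<close>.\<close>

lemma middle_count_pos:
  assumes "and x y = 0 \<or> and y z = 0"
  shows "middle_count y x z > 0"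
proof -
  have "y \<in> {i. i \<le> y \<and> and x i = 0 \<and> and (y - i) z = 0} \<or>
      0 \<in> {i. i \<le> y \<and> and x i = 0 \<and> and (y - i) z = 0}"
    using assms by auto
  then show ?thesis
    unfolding middle_count_def by (subst card_gt_0_iff) auto
qed

lemma and_eq_0_if_mod:
  fixes x y :: nat
  assumes "x mod 2 ^ n = 0" "y < 2 ^ n"
  shows "and x y = 0"
proof -
  have y: "take_bit n y = y"
    using assms by (simp add: take_bit_nat_eq_self)
  have "and x y = and x (take_bit n y)"
    by (simp only: y)
  also have "\<dots> = and (take_bit n x) y"
    by (simp only: take_bit_eq_mask ac_simps)
  finally show ?thesis
    using assms by (simp add: take_bit_eq_mod)
qed

section \<open>Counts for \<open>2 ^ k - 1\<close> and \<open>2 ^ k - 2\<close>\<close>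

lemma mod_pow2_Suc_eq_iff:
  fixes n k :: nat
  shows "n mod 2 ^ Suc k = 2 ^ Suc k - 1 \<longleftrightarrow> odd n \<and> n div 2 mod 2 ^ k = 2 ^ k - 1"
    and "n mod 2 ^ Suc k = 0 \<longleftrightarrow> even n \<and> n div 2 mod 2 ^ k = 0"
proof -
  have eq: "n mod 2 ^ Suc k = 2 * (n div 2 mod 2 ^ k) + n mod 2"
    unfolding power_Suc by (rule mod_mult2_eq)
  have *: "2 * r + n mod 2 = 2 * p - 1 \<longleftrightarrow> odd n \<and> r = p - 1" if "p > 0" for r p :: nat
  proof (cases "odd n")
    case True
    then have "n mod 2 = 1" by presburger
    with True that show ?thesis by auto
  next
    case False
    then have "n mod 2 = 0" by presburger
    moreover have "2 * r \<noteq> 2 * p - 1" using that by presburger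
    ultimately show ?thesis using False by simp
  qed
  show "n mod 2 ^ Suc k = 2 ^ Suc k - 1 \<longleftrightarrow> odd n \<and> n div 2 mod 2 ^ k = 2 ^ k - 1"
    unfolding eq unfolding power_Suc by (rule *) simp
  show "n mod 2 ^ Suc k = 0 \<longleftrightarrow> even n \<and> n div 2 mod 2 ^ k = 0"
    unfolding eq by (simp add: even_iff_mod_2_eq_zero conj_commute)
qed

lemma add_div_2_eq:
  "even x \<or> even z \<Longrightarrow> (x + z) div 2 = x div 2 + z div (2::nat)"
  "odd x \<Longrightarrow> odd z \<Longrightarrow> (x + z) div 2 = x div 2 + z div 2 + 1"
  by presburger+

lemma middle_count_pow2_minus_1_Suc:
  "middle_count (2 ^ Suc k - 1) x z =
    (of_bool (even x) + of_bool (even z)) * middle_count (2 ^ k - 1) (x div 2) (z div 2)"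
proof -
  have "(2::nat) ^ k > 0" by simp
  then have "(2::nat) ^ Suc k - 1 = 2 * (2 ^ k - 1) + 1"
    unfolding power_Suc by linarith
  then show ?thesis by (simp only: middle_count_odd)
qed

text \<open>The count is a product of factors 0, 1, 2, one per digit. It is 1 iff each factor is,
  that is, iff the last \<open>k\<close> digits of \<open>x\<close> and \<open>z\<close> are
  complementary.\<close>

lemma middle_count_pow2_minus_1_eq_1_iff:
  "middle_count (2 ^ k - 1) x z = 1 \<longleftrightarrow> (x + z) mod 2 ^ k = 2 ^ k - 1"
proof (induction k arbitrary: x z)
  case (Suc k)
  note rules = middle_count_pow2_minus_1_Suc mod_pow2_Suc_eq_iff
  show ?case
  proof (cases "even x \<longleftrightarrow> even z")
    case True
    then have "even (x + z)" "of_bool (even x) + of_bool (even z) = (2 * of_bool (even x) :: nat)"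
      by (cases "even x"; simp)+
    then show ?thesis
      unfolding rules by simp
  next
    case False
    then have "odd (x + z)" "(x + z) div 2 = x div 2 + z div 2"
      using add_div_2_eq by auto
    moreover have "of_bool (even x) + of_bool (even z) = (1::nat)"
      using False by (cases "even x") simp_all
    ultimately show ?thesis
      unfolding rules using Suc.IH[of "x div 2" "z div 2"] by simp
  qed
qed simp

text \<open>At the lowest nonzero digit of \<open>x\<close> the number \<open>z\<close> also has
  digit 1, and that factor vanishes.\<close>

lemma middle_count_pow2_minus_1_eq_0:
  "(x + z) mod 2 ^ k = 0 \<Longrightarrow> x mod 2 ^ k \<noteq> 0 \<Longrightarrow> middle_count (2 ^ k - 1) x z = 0"
proof (induction k arbitrary: x z)
  case (Suc k)
  have "even (x + z)" "(x + z) div 2 mod 2 ^ k = 0" "odd x \<or> x div 2 mod 2 ^ k \<noteq> 0"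
    using Suc.prems unfolding mod_pow2_Suc_eq_iff by auto
  moreover have "(x + z) div 2 = x div 2 + z div 2" if "even x" "even z"
    using that add_div_2_eq by simp
  ultimately have "odd x \<and> odd z \<or> middle_count (2 ^ k - 1) (x div 2) (z div 2) = 0"
    using Suc.IH[of "x div 2" "z div 2"] by auto
  then show ?case
    unfolding middle_count_pow2_minus_1_Suc by auto
qed simp

lemma middle_count_pow2_minus_2:
  "middle_count (2 ^ Suc k - 2) x z = middle_count (2 ^ k - 1) (x div 2) (z div 2) +
    (if even x \<and> even z \<and> k > 0 then middle_count (2 ^ k - 2) (x div 2) (z div 2) else 0)"
proof -
  have eq: "(2::nat) ^ Suc k - 2 = 2 * (2 ^ k - 1)" "(2::nat) ^ k - 1 - 1 = 2 ^ k - 2"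
    by (simp_all add: diff_mult_distrib2)
  have pos: "(2::nat) ^ k - 1 > 0 \<longleftrightarrow> k > 0"
    using one_less_power[of "2::nat" k] by (cases "k = 0") auto
  show ?thesis
    unfolding eq(1) middle_count_even eq(2) pos ..
qed

text \<open>The second alternative means that the residues of \<open>x\<close> and \<open>z\<close>
  add up to exactly \<open>2 ^ k\<close>. The induction starts at 2 because for \<open>k = 1\<close>
  the number is 0 and every count is 1.\<close>

lemma middle_count_pow2_minus_2_eq_1_iff:
  assumes "k \<ge> 2"
  shows "middle_count (2 ^ k - 2) x z = 1 \<longleftrightarrow>
    (x + z) mod 2 ^ k = 2 ^ k - 1 \<or> (x + z) mod 2 ^ k = 0 \<and> x mod 2 ^ k \<noteq> 0"
  using assms
proof (induction k arbitrary: x z rule: dec_induct)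
  case base
  have "middle_count (2 ^ 2 - 2) x z = middle_count (2 ^ 1 - 1) (x div 2) (z div 2) +
      (if even x \<and> even z then 1 else 0)"
    using middle_count_pow2_minus_2[of 1 x z] by (simp add: numeral_2_eq_2)
  also have "middle_count (2 ^ 1 - 1) (x div 2) (z div 2) = of_bool (even (x div 2)) + of_bool (even (z div 2))"
    using middle_count_pow2_minus_1_Suc[of 0 "x div 2" "z div 2"] by simp
  finally have *: "middle_count (2 ^ 2 - 2) x z = of_bool (even (x div 2)) + of_bool (even (z div 2)) +
      (if even x \<and> even z then 1 else 0)" .
  have "x mod 2 ^ 2 = 2 * (x div 2 mod 2) + x mod 2" "z mod 2 ^ 2 = 2 * (z div 2 mod 2) + z mod 2"
    using mod_mult2_eq[of x 2 2] mod_mult2_eq[of z 2 2] by simp_all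
  moreover have "(x + z) mod 2 ^ 2 = (x mod 2 ^ 2 + z mod 2 ^ 2) mod 2 ^ 2"
    by (simp add: mod_add_eq)
  ultimately show ?case
    unfolding * mod_2_eq_odd
    by (cases "even x"; cases "even z"; cases "even (x div 2)"; cases "even (z div 2)") simp_all
next
  case (step k)
  let ?x = "x div 2" and ?z = "z div 2"
  note E1 = middle_count_pow2_minus_1_eq_1_iff[of k ?x ?z]
  have E0: "middle_count (2 ^ k - 1) ?x ?z = 0" if "(?x + ?z) mod 2 ^ k = 0" "?x mod 2 ^ k \<noteq> 0"
    using middle_count_pow2_minus_1_eq_0[OF that] .
  have pow: "(2::nat) ^ k > 1"
    by (rule one_less_power) (use step.hyps in auto)
  show ?case
  proof (cases "even x \<and> even z")
    case True
    define A where "A = middle_count (2 ^ k - 1) ?x ?z"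
    define B where "B = middle_count (2 ^ k - 2) ?x ?z"
    define r where "r = (?x + ?z) mod 2 ^ k"
    have "middle_count (2 ^ Suc k - 2) x z = A + B"
      using True step.hyps unfolding middle_count_pow2_minus_2 A_def B_def by auto
    moreover have "A = 1 \<longleftrightarrow> r = 2 ^ k - 1"
      unfolding A_def r_def by (rule E1)
    moreover have "B = 1 \<longleftrightarrow> r = 2 ^ k - 1 \<or> r = 0 \<and> ?x mod 2 ^ k \<noteq> 0"
      unfolding B_def r_def by (rule step.IH)
    moreover have "r = 0 \<and> ?x mod 2 ^ k \<noteq> 0 \<longrightarrow> A = 0"
      using E0 unfolding A_def r_def by simp
    \<comment> \<open>Residue \<open>2 ^ k - 1\<close> makes \<open>A\<close> and \<open>B\<close>
      both 1, which is too much. The only way to total 1 is \<open>A = 0\<close>,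
      \<open>B = 1\<close>.\<close>
    ultimately have "middle_count (2 ^ Suc k - 2) x z = 1 \<longleftrightarrow> r = 0 \<and> ?x mod 2 ^ k \<noteq> 0"
      using pow by linarith
    moreover have "(x + z) div 2 = ?x + ?z" "even (x + z)"
      using True add_div_2_eq by auto
    ultimately show ?thesis
      unfolding mod_pow2_Suc_eq_iff r_def using True by simp
  next
    case False
    then have eq: "middle_count (2 ^ Suc k - 2) x z = middle_count (2 ^ k - 1) ?x ?z"
      unfolding middle_count_pow2_minus_2 by auto
    show ?thesis
    proof (cases "odd x \<and> odd z")
      case True
      \<comment> \<open>For two odd numbers the carry turns residue \<open>2 ^ k - 1\<close> of the
        sum of halves into 0.\<close>
      have "(m + 1) mod 2 ^ k = 0 \<longleftrightarrow> m mod 2 ^ k = 2 ^ k - 1" for m :: nat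
        using pow by (auto simp: mod_Suc)
      moreover have "even (x + z)" "(x + z) div 2 = ?x + ?z + 1"
        using True add_div_2_eq by auto
      ultimately show ?thesis
        unfolding eq E1 mod_pow2_Suc_eq_iff using True by (simp only:) simp
    next
      case odd: False
      with False have "odd (x + z)" "(x + z) div 2 = ?x + ?z"
        using add_div_2_eq by auto
      then show ?thesis
        unfolding eq E1 mod_pow2_Suc_eq_iff by (simp only:) simp
    qed
  qed
qed

section \<open>Splitting off a block of trailing ones\<close>

lemma div_pow2_Suc: "(x::nat) div 2 ^ Suc a = x div 2 div 2 ^ a"
  by (simp add: div_mult2_eq)

text \<open>A sum ending in \<open>a\<close> ones arises there without carries: at each of these
  digits exactly one of \<open>x\<close>, \<open>z\<close> has a 1. So the low parts never meet and
  the quotients simply add.\<close>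

lemma add_eq_pow2_block_iff:
  fixes x z Y :: nat
  assumes "x + z = 2 ^ a * Y + 2 ^ a - 1"
  shows "and x z = 0 \<longleftrightarrow> and (x div 2 ^ a) (z div 2 ^ a) = 0"
    and "x div 2 ^ a + z div 2 ^ a = Y"
proof -
  have "(and x z = 0 \<longleftrightarrow> and (x div 2 ^ a) (z div 2 ^ a) = 0) \<and> x div 2 ^ a + z div 2 ^ a = Y"
    using assms
  proof (induction a arbitrary: x z)
    case (Suc a)
    have "(2::nat) ^ a > 0" by simp
    then have "(2::nat) ^ Suc a * Y + 2 ^ Suc a - 1 = 2 * (2 ^ a * Y + 2 ^ a - 1) + 1"
      unfolding power_Suc mult.assoc by linarith
    with Suc.prems have "x + z = 2 * (2 ^ a * Y + 2 ^ a - 1) + 1"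
      by (simp only:)
    moreover have "(even x \<or> even z) \<and> x div 2 + z div 2 = M" if "x + z = 2 * M + 1" for M
      using that by presburger
    ultimately have "even x \<or> even z" "x div 2 + z div 2 = 2 ^ a * Y + 2 ^ a - 1"
      by blast+
    then show ?case
      using Suc.IH[of "x div 2" "z div 2"] and_eq_0_rec[of x z]
      by (simp only: div_pow2_Suc simp_thms)
  qed simp
  then show "and x z = 0 \<longleftrightarrow> and (x div 2 ^ a) (z div 2 ^ a) = 0" "x div 2 ^ a + z div 2 ^ a = Y"
    by auto
qed

lemma and_eq_0_if_add_eq:
  fixes x z :: nat
  assumes "x + z = 2 ^ a - 1"
  shows "and x z = 0"
proof -
  have "x div 2 ^ a = 0"
    using add_eq_pow2_block_iff(2)[of x z a 0] assms by simp
  then show ?thesis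
    using add_eq_pow2_block_iff(1)[of x z a 0] assms by simp
qed

text \<open>Each trailing one contributes its parity factor whatever stands above it; together these
  factors are the count for \<open>2 ^ a - 1\<close>.\<close>

lemma middle_count_block:
  "middle_count (2 ^ a * y + 2 ^ a - 1) x z =
    middle_count (2 ^ a - 1) x z * middle_count y (x div 2 ^ a) (z div 2 ^ a)"
proof (induction a arbitrary: x z)
  case (Suc a)
  have "(2::nat) ^ a > 0" by simp
  then have "(2::nat) ^ Suc a * y + 2 ^ Suc a - 1 = 2 * (2 ^ a * y + 2 ^ a - 1) + 1"
    unfolding power_Suc mult.assoc by linarith
  then have "middle_count (2 ^ Suc a * y + 2 ^ Suc a - 1) x z =
      (of_bool (even x) + of_bool (even z)) * middle_count (2 ^ a * y + 2 ^ a - 1) (x div 2) (z div 2)"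
    by (simp only: middle_count_odd)
  then show ?case
    by (simp only: Suc.IH middle_count_pow2_minus_1_Suc div_pow2_Suc mult.assoc)
qed simp

text \<open>For even \<open>x\<close> the count is 2 and the cut into equal halves is removed. For
  odd \<open>x\<close> also \<open>z\<close> is odd, so there is no such cut, and the count itself
  differs from 1.\<close>

lemma middle_count_diag_eq_1_iff:
  assumes "k \<ge> 2" and sum: "x + z = 2 ^ k - 2"
  shows "middle_count (2 ^ k - 2) x z - of_bool (and x z = 0) = 1 \<longleftrightarrow> even x"
proof -
  obtain m where m: "k = Suc m" "m \<ge> 1"
    using assms(1) by (cases k) auto
  let ?x = "x div 2" and ?z = "z div 2"
  have sum': "x + z = 2 * (2 ^ m - 1)"
    using sum m by (simp add: diff_mult_distrib2)
  then have parity: "even x \<longleftrightarrow> even z" by presburger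
  have pow: "(2::nat) ^ m \<ge> 2"
    using m(2) by (cases m) auto
  show ?thesis
  proof (cases "even x")
    case True
    then have "x = 2 * ?x" "z = 2 * ?z"
      using parity by auto
    then have eq: "?x + ?z = 2 ^ m - 1"
      using sum' by linarith
    then have "middle_count (2 ^ m - 1) ?x ?z = 1"
      using middle_count_pow2_minus_1_eq_1_iff by simp
    moreover have "middle_count (2 ^ m - 2) ?x ?z = 1"
    \<comment> \<open>For \<open>m = 1\<close> this is the count for 0, which the general criterion
      does not cover.\<close>
    proof (cases "m = 1")
      case False
      then show ?thesis
        using eq m(2) middle_count_pow2_minus_2_eq_1_iff[of m ?x ?z] by simp
    qed simp
    moreover have "and x z = 0"
      using and_eq_0_rec[of x z] True and_eq_0_if_add_eq[OF eq] by simp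
    ultimately show ?thesis
      unfolding m(1) middle_count_pow2_minus_2 using True parity m(2) by simp
  next
    case False
    then have "x = 2 * ?x + 1" "z = 2 * ?z + 1"
      using parity by auto
    then have "?x + ?z = 2 ^ m - 2"
      using sum' by linarith
    then have "(?x + ?z) mod 2 ^ m \<noteq> 2 ^ m - 1"
      using pow by simp
    moreover have "and x z \<noteq> 0"
      using and_eq_0_rec[of x z] False parity by simp
    ultimately show ?thesis
      unfolding m(1) middle_count_pow2_minus_2
      using False middle_count_pow2_minus_1_eq_1_iff[of m ?x ?z] by simp
  qed
qed

subsection \<open>The sets \<open>Ulam[y]\<close> for Zumkeller \<open>y\<close>\<close>

lemma cong_minus_1_iff: "[int s = -1] (mod 2 ^ n) \<longleftrightarrow> s mod 2 ^ n = 2 ^ n - 1"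
proof -
  have "[int s = -1] (mod 2 ^ n) \<longleftrightarrow> 2 ^ n dvd int s - (-1)"
    by (rule cong_iff_dvd_diff)
  also have "int s - (-1) = int (Suc s)" by simp
  also have "(2::int) ^ n = int (2 ^ n)" by simp
  also have "int (2 ^ n) dvd int (Suc s) \<longleftrightarrow> Suc s mod 2 ^ n = 0"
    unfolding int_dvd_int_iff by (rule dvd_eq_mod_eq_0)
  also have "\<dots> \<longleftrightarrow> s mod 2 ^ n = 2 ^ n - 1"
    unfolding mod_Suc by auto
  finally show ?thesis by simp
qed

lemma diff_1_mod:
  fixes n P :: nat
  assumes "n > 0" "P > 0"
  shows "(n - 1) mod P = (if n mod P = 0 then P - 1 else n mod P - 1)"
proof -
  have "n mod P = (if Suc ((n - 1) mod P) = P then 0 else Suc ((n - 1) mod P))"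
    using mod_Suc[of "n - 1" P] assms(1) by simp
  then show ?thesis
    by (auto split: if_splits)
qed

lemma diff_1_mod_eq_iff:
  fixes n P :: nat
  assumes "n > 0" "P > 0"
  shows "(n - 1) mod P = P - 1 \<longleftrightarrow> n mod P = 0"
proof -
  have "n mod P < P" using assms by simp
  then show ?thesis
    unfolding diff_1_mod[OF assms] by auto
qed

text \<open>As \<open>y\<close> has digits only below \<open>n\<close>, an extreme cut survives.
  This serves border pairs above all, where one of the neighbours is missing.\<close>

lemma middle_count_pos_if_mod:
  assumes "x mod 2 ^ n = 0 \<or> z mod 2 ^ n = 0" "y < 2 ^ n"
  shows "middle_count y x z > 0"
proof -
  have "and x y = 0 \<or> and z y = 0"
    using assms and_eq_0_if_mod[of _ n y] by auto
  then show ?thesis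
    by (intro middle_count_pos) (simp only: and.commute[of y z])
qed

lemma Ulam_pow2_minus_1:
  "Ulam (2 ^ Suc k - 1) =
    {(x, z). (x + z) mod 2 ^ Suc k = 2 ^ Suc k - 1 \<and> x + z \<noteq> 2 ^ Suc k - 1}"
proof (rule Ulam_eqI)
  fix x z :: nat
  define P :: nat where "P = 2 ^ Suc k"
  have P: "P \<ge> 2"
    using zero_less_power[of "2::nat" k] unfolding P_def power_Suc by simp
  define s where "s = x + z"
  define M where "M = middle_count (P - 1) x z"
  have M1: "M = 1 \<longleftrightarrow> s mod P = P - 1"
    unfolding M_def s_def P_def by (rule middle_count_pow2_minus_1_eq_1_iff)
  have M0: "M > 0" if "x = 0 \<or> z = 0"
    using that P unfolding M_def P_def by (intro middle_count_pos_if_mod[where n = "Suc k"]) auto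
  \<comment> \<open>On row \<open>P - 1\<close> the only middle cut has equal halves, which is why
    this row drops out.\<close>
  have "and x z = 0" if "s = P - 1"
    using that unfolding s_def P_def by (rule and_eq_0_if_add_eq)
  then have excl: "(s = P - 1 \<and> and x z = 0) = (s = P - 1)"
    by blast
  define S where "S = {(x, z). (x + z) mod P = P - 1 \<and> x + z \<noteq> P - 1}"
  have mem: "(x, z) \<in> S \<longleftrightarrow> s mod P = P - 1 \<and> s \<noteq> P - 1"
    by (simp add: S_def s_def)
  have nb: "(x - 1, z) \<in> S \<longleftrightarrow> s mod P = 0 \<and> s \<noteq> P" if "x > 0"
  proof -
    have s: "x - 1 + z = s - 1" "s > 0" using that by (simp_all add: s_def)
    then have "s - 1 \<noteq> P - 1 \<longleftrightarrow> s \<noteq> P" using P by auto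
    with s show ?thesis using P unfolding S_def mem_Collect_eq prod.case by (simp add: diff_1_mod_eq_iff del: One_nat_def)
  qed
  have nb': "(x, z - 1) \<in> S \<longleftrightarrow> s mod P = 0 \<and> s \<noteq> P" if "z > 0"
  proof -
    have s: "x + (z - 1) = s - 1" "s > 0" using that by (simp_all add: s_def)
    then have "s - 1 \<noteq> P - 1 \<longleftrightarrow> s \<noteq> P" using P by auto
    with s show ?thesis using P unfolding S_def mem_Collect_eq prod.case by (simp add: diff_1_mod_eq_iff del: One_nat_def)
  qed
  have "(x, z) \<in> S \<longleftrightarrow> of_bool (x > 0 \<and> (x - 1, z) \<in> S) + of_bool (z > 0 \<and> (x, z - 1) \<in> S) +
      (M - of_bool (s = P - 1 \<and> and x z = 0)) = (1 :: nat)"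
  proof (cases "s mod P = P - 1")
    case True
    then have "\<not> (x > 0 \<and> (x - 1, z) \<in> S)" "\<not> (z > 0 \<and> (x, z - 1) \<in> S)" "M = 1"
      using nb nb' P M1 by auto
    then show ?thesis
      unfolding mem excl using True by auto
  next
    case False
    then have s: "s \<noteq> P - 1" "M \<noteq> 1" using P M1 by auto
    show ?thesis
    \<comment> \<open>Only rows after \<open>P\<close> inherit neighbours from the set: row
      \<open>P - 1\<close> is empty, so at \<open>s = P\<close> the count alone decides.\<close>
    proof (cases "s mod P = 0 \<and> s \<noteq> P \<and> s > 0")
      case True
      then have "(x > 0 \<and> (x - 1, z) \<in> S) = (x > 0)" "(z > 0 \<and> (x, z - 1) \<in> S) = (z > 0)"
        using nb nb' by auto
      moreover have "x > 0 \<or> z > 0" using True by (auto simp: s_def)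
      ultimately show ?thesis
        unfolding mem excl using False s M0 by (cases "x = 0"; cases "z = 0") auto
    next
      case nnb: False
      then have "\<not> (x > 0 \<and> (x - 1, z) \<in> S)" "\<not> (z > 0 \<and> (x, z - 1) \<in> S)"
        using nb nb' by (auto simp: s_def)
      then show ?thesis
        unfolding mem excl using False s by auto
    qed
  qed
  then show "((x, z) \<in> {(x, z). (x + z) mod 2 ^ Suc k = 2 ^ Suc k - 1 \<and> x + z \<noteq> 2 ^ Suc k - 1}) =
    (of_bool (x > 0 \<and> (x - 1, z) \<in> {(x, z). (x + z) mod 2 ^ Suc k = 2 ^ Suc k - 1 \<and> x + z \<noteq> 2 ^ Suc k - 1}) +
     of_bool (z > 0 \<and> (x, z - 1) \<in> {(x, z). (x + z) mod 2 ^ Suc k = 2 ^ Suc k - 1 \<and> x + z \<noteq> 2 ^ Suc k - 1}) +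
     (middle_count (2 ^ Suc k - 1) x z - of_bool (x + z = 2 ^ Suc k - 1 \<and> and x z = 0)) = 1)"
    unfolding S_def M_def s_def P_def .
qed

text \<open>Discarding equal halves puts the even pairs of row \<open>2 ^ k - 2\<close> into the
  set. Each pair of the next row then has one neighbour there besides its single middle cut, so that
  row is empty, and row \<open>2 ^ k\<close> keeps its pairs with one middle cut. Larger multiples
  of \<open>2 ^ k\<close> are blocked by the row before them.\<close>

lemma Ulam_pow2_minus_2:
  assumes "k \<ge> 2"
  shows "Ulam (2 ^ k - 2) =
    {(x, z). (x + z) mod 2 ^ k = 2 ^ k - 1 \<and> x + z \<noteq> 2 ^ k - 1 \<or>
      x + z = 2 ^ k - 2 \<and> even x \<and> even z \<or> x + z = 2 ^ k \<and> x > 0 \<and> z > 0}"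
proof -
  define P :: nat where "P = 2 ^ k"
  have "(2::nat) ^ 2 \<le> P"
    unfolding P_def by (rule power_increasing) (use assms in auto)
  then have P: "P \<ge> 4" by simp
  have evenP: "even P"
    using assms by (simp add: P_def)
  define S where "S = {(x, z). (x + z) mod P = P - 1 \<and> x + z \<noteq> P - 1 \<or>
      x + z = P - 2 \<and> even x \<and> even z \<or> x + z = P \<and> x > 0 \<and> z > 0}"
  have "Ulam (P - 2) = S"
  proof (rule Ulam_eqI)
    fix x z :: nat
    define s where "s = x + z"
    define r where "r = s mod P"
    define M where "M = middle_count (P - 2) x z"
    define D where "D = M - of_bool (s = P - 2 \<and> and x z = 0)"
    define nx where "nx \<longleftrightarrow> x > 0 \<and> (x - 1, z) \<in> S"
    define nz where "nz \<longleftrightarrow> z > 0 \<and> (x, z - 1) \<in> S"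
    have M1: "M = 1 \<longleftrightarrow> r = P - 1 \<or> r = 0 \<and> x mod P \<noteq> 0"
      unfolding M_def r_def s_def P_def by (rule middle_count_pow2_minus_2_eq_1_iff[OF assms])
    have M0: "M > 0" if "x mod P = 0 \<or> z mod P = 0"
      using that P unfolding M_def P_def by (intro middle_count_pos_if_mod[where n = k]) auto
    have D_eq: "D = M" if "s \<noteq> P - 2"
      using that by (simp add: D_def)
    have mem: "(x, z) \<in> S \<longleftrightarrow> r = P - 1 \<and> s \<noteq> P - 1 \<or> s = P - 2 \<and> even x \<and> even z \<or>
        s = P \<and> x > 0 \<and> z > 0"
      by (simp add: S_def s_def r_def)
    have shift: "(s - 1) mod P = P - 1 \<longleftrightarrow> r = 0" "s - 1 \<noteq> P - 1 \<longleftrightarrow> s \<noteq> P"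
      "s - 1 = P - 2 \<longleftrightarrow> s = P - 1" "s - 1 = P \<longleftrightarrow> s = P + 1" if "s > 0"
      using that P diff_1_mod_eq_iff[of s P] by (auto simp: r_def)
    have nx: "nx \<longleftrightarrow> x > 0 \<and> (r = 0 \<and> s \<noteq> P \<or> s = P - 1 \<and> odd x \<and> even z \<or> s = P + 1 \<and> x > 1 \<and> z > 0)"
    proof (cases "x > 0")
      case True
      then have "x - 1 + z = s - 1" "s > 0" "even (x - 1) \<longleftrightarrow> odd x"
        by (simp_all add: s_def)
      then show ?thesis
        unfolding nx_def S_def mem_Collect_eq prod.case by (simp only: shift) auto
    qed (simp add: nx_def)
    have nz: "nz \<longleftrightarrow> z > 0 \<and> (r = 0 \<and> s \<noteq> P \<or> s = P - 1 \<and> even x \<and> odd z \<or> s = P + 1 \<and> x > 0 \<and> z > 1)"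
    proof (cases "z > 0")
      case True
      then have "x + (z - 1) = s - 1" "s > 0" "even (z - 1) \<longleftrightarrow> odd z"
        by (simp_all add: s_def)
      then show ?thesis
        unfolding nz_def S_def mem_Collect_eq prod.case by (simp only: shift) auto
    qed (simp add: nz_def)
    have small: "s < P \<Longrightarrow> r = s" "s = P \<Longrightarrow> r = 0" "s = P + 1 \<Longrightarrow> r = 1"
      using P by (auto simp: r_def mod_Suc)
    \<comment> \<open>Rows \<open>P - 2\<close> to \<open>P + 1\<close> feel the cut into equal
      halves; elsewhere the residue decides.\<close>
    consider (a) "s = P - 1" | (b) "s = P - 2" | (c) "s = P" | (d) "s = P + 1"
      | (e) "r = P - 1" "s \<noteq> P - 1" "s \<noteq> P - 2" "s \<noteq> P" "s \<noteq> P + 1"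
      | (f) "r = 0" "s \<noteq> P - 1" "s \<noteq> P - 2" "s \<noteq> P" "s \<noteq> P + 1"
      | (g) "r \<noteq> P - 1" "r \<noteq> 0" "s \<noteq> P - 1" "s \<noteq> P - 2" "s \<noteq> P" "s \<noteq> P + 1"
      by blast
    then have "(x, z) \<in> S \<longleftrightarrow> of_bool nx + of_bool nz + D = (1 :: nat)"
    proof cases
      case a
      then have "r = P - 1" using small P by simp
      then have "D = 1" using D_eq M1 a P by simp
      moreover have "odd s" using a P evenP by simp
      then have "odd x \<and> even z \<or> even x \<and> odd z" by (auto simp: s_def)
      then have "nx \<or> nz" unfolding nx nz using a by (auto intro: odd_pos)
      moreover have "(x, z) \<notin> S" unfolding mem using a P by auto
      ultimately show ?thesis by auto
    next
      case b
      then have r: "r = P - 2" using small P by simp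
      have "D = 1 \<longleftrightarrow> even x"
        using middle_count_diag_eq_1_iff[OF assms, of x z] b
        by (simp add: D_def M_def P_def s_def)
      moreover have "even s" using b P evenP by simp
      then have "even x \<longleftrightarrow> even z" by (auto simp: s_def)
      moreover have "\<not> nx" "\<not> nz" unfolding nx nz using b r P by auto
      ultimately show ?thesis unfolding mem using b r P by auto
    next
      case c
      then have r: "r = 0" using small by simp
      have "\<not> nx" "\<not> nz" unfolding nx nz using c P by auto
      moreover have "x mod P \<noteq> 0 \<longleftrightarrow> x > 0 \<and> z > 0"
      proof (cases "z = 0")
        case False
        then show ?thesis using c by (simp add: s_def)
      qed (use c in \<open>simp add: s_def\<close>)
      then have "D = 1 \<longleftrightarrow> x > 0 \<and> z > 0" using D_eq M1 r c P by simp
      ultimately show ?thesis unfolding mem using c r P by auto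
    next
      case d
      then have r: "r = 1" using small by simp
      have M: "D = M" "M \<noteq> 1" using D_eq M1 r d P by simp_all
      have notin: "(x, z) \<notin> S" unfolding mem using d r P by auto
      have n: "nx \<longleftrightarrow> x > 1 \<and> z > 0" "nz \<longleftrightarrow> x > 0 \<and> z > 1"
        unfolding nx nz using r d P by auto
      \<comment> \<open>Next to the border one neighbour lies on it and is outside \<open>S\<close>;
        the extreme cut provided by the coordinate \<open>P\<close> compensates.\<close>
      consider "x = 0" | "z = 0" | "x = 1" "z = P" | "z = 1" "x = P" | "x > 1" "z > 1"
        using d unfolding s_def by linarith
      then show ?thesis
      proof cases
        case 3
        then have "M > 0" using M0 by simp
        then show ?thesis using notin n M 3 P by simp
      next
        case 4
        then have "M > 0" using M0 by simp
        then show ?thesis using notin n M 4 P by simp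
      qed (use notin n M in auto)
    next
      case e
      then have "\<not> nx" "\<not> nz" "D = 1" "(x, z) \<in> S"
        unfolding nx nz mem using P D_eq M1 by auto
      then show ?thesis by simp
    next
      case f
      then have n: "nx \<longleftrightarrow> x > 0" "nz \<longleftrightarrow> z > 0" unfolding nx nz by auto
      have notin: "(x, z) \<notin> S" unfolding mem using f P by simp
      have "M \<noteq> 1" if "x = 0" "z = 0" using that M1 f P by simp
      moreover have "M > 0" if "x = 0 \<or> z = 0" using that M0 by auto
      ultimately show ?thesis using notin D_eq f n by (cases "x = 0"; cases "z = 0") auto
    next
      case g
      then have "\<not> nx" "\<not> nz" "D \<noteq> 1" "(x, z) \<notin> S"
        unfolding nx nz mem using P D_eq M1 by auto
      then show ?thesis by simp
    qed
    then show "((x, z) \<in> S) = (of_bool (x > 0 \<and> (x - 1, z) \<in> S) + of_bool (z > 0 \<and> (x, z - 1) \<in> S) +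
        (middle_count (P - 2) x z - of_bool (x + z = P - 2 \<and> and x z = 0)) = (1 :: nat))"
      unfolding nx_def nz_def D_def M_def s_def .
  qed
  then show ?thesis unfolding S_def P_def .
qed


text \<open>In binary the number is \<open>m - 1\<close> ones, a zero, then \<open>a\<close> ones.
  \<open>middle_count_block\<close> makes the count a product, so both factors must be 1; the two
  alternatives for the upper factor give the two alternatives here.\<close>

lemma middle_count_two_blocks_eq_1_iff:
  fixes a m x z :: nat
  assumes "m \<ge> 2"
  defines "P \<equiv> 2 ^ (a + m) :: nat" and "Q \<equiv> 2 ^ a"
  shows "middle_count (Q * (2 ^ m - 2) + Q - 1) x z = 1 \<longleftrightarrow>
    (x + z) mod P = P - 1 \<or> x mod P + z mod P = P + Q - 1"
proof -
  define R :: nat where "R = 2 ^ m"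
  have PQR: "P = Q * R" and pos: "Q > 0" "R > 1"
    using assms(1) one_less_power[of "2::nat" m] by (simp_all add: P_def Q_def R_def power_add)
  define e f where "e = x mod Q" and "f = z mod Q"
  define u v where "u = x div Q mod R" and "v = z div Q mod R"
  have lt: "e < Q" "f < Q" "u < R" "v < R"
    using pos by (simp_all add: e_def f_def u_def v_def)
  have x: "x mod P = Q * u + e" and z: "z mod P = Q * v + f"
    by (simp_all add: PQR mod_mult2_eq e_def f_def u_def v_def)
  have count: "middle_count (Q * (2 ^ m - 2) + Q - 1) x z = 1 \<longleftrightarrow>
      (x + z) mod Q = Q - 1 \<and> ((x div Q + z div Q) mod R = R - 1 \<or>
        (x div Q + z div Q) mod R = 0 \<and> u \<noteq> 0)"
    unfolding Q_def R_def u_def middle_count_block nat_mult_eq_1_iff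
      middle_count_pow2_minus_1_eq_1_iff middle_count_pow2_minus_2_eq_1_iff[OF assms(1)] ..
  have low: "(x + z) mod Q = Q - 1 \<longleftrightarrow> e + f = Q - 1"
  proof -
    have "(x + z) mod Q = (e + f) mod Q"
      by (simp add: e_def f_def mod_add_eq)
    also have "\<dots> = (if e + f < Q then e + f else e + f - Q)"
      using lt by (simp add: mod_if)
    finally show ?thesis
      using lt by auto
  qed
  \<comment> \<open>Both residues are below \<open>R\<close>, so a sum divisible by \<open>R\<close>
    with \<open>u\<close> nonzero is \<open>R\<close> itself.\<close>
  have high: "(x div Q + z div Q) mod R = 0 \<and> u \<noteq> 0 \<longleftrightarrow> u + v = R"
  proof -
    have "(x div Q + z div Q) mod R = (u + v) mod R"
      by (simp add: u_def v_def mod_add_eq)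
    also have "\<dots> = (if u + v < R then u + v else u + v - R)"
      using lt by (simp add: mod_if)
    finally show ?thesis
      using lt by auto
  qed
  have "x mod P + z mod P = P + Q - 1 \<longleftrightarrow> e + f = Q - 1 \<and> u + v = R"
  proof
    assume *: "x mod P + z mod P = P + Q - 1"
    have sum: "Q * (u + v) + (e + f) = Q * R + (Q - 1)"
      using * pos unfolding x z unfolding PQR by (simp add: algebra_simps)
    then have "(Q * (u + v) + (e + f)) mod Q = (Q * R + (Q - 1)) mod Q"
      by simp
    then have "(e + f) mod Q = Q - 1"
      unfolding mod_mult_self4 using pos by simp
    moreover have "(e + f) mod Q = (x + z) mod Q"
      by (simp add: e_def f_def mod_add_eq)
    ultimately have "e + f = Q - 1"
      using low by simp
    with sum have "Q * (u + v) = Q * R" by linarith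
    with pos \<open>e + f = Q - 1\<close> show "e + f = Q - 1 \<and> u + v = R" by simp
  next
    assume *: "e + f = Q - 1 \<and> u + v = R"
    then have "Q * (u + v) + (e + f) = P + (Q - 1)"
      by (simp add: PQR)
    then show "x mod P + z mod P = P + Q - 1"
      using pos unfolding x z by (simp add: algebra_simps)
  qed
  moreover have "(x + z) mod P = P - 1 \<longleftrightarrow>
      (x + z) mod Q = Q - 1 \<and> (x div Q + z div Q) mod R = R - 1"
  proof -
    have "(x + z) mod P = Q * ((x + z) div Q mod R) + (x + z) mod Q"
      unfolding PQR by (rule mod_mult2_eq)
    moreover have "Q * q + t = P - 1 \<longleftrightarrow> t = Q - 1 \<and> q = R - 1" if "t < Q" for q t
    proof
      assume eq: "Q * q + t = P - 1"
      have "P - 1 = Q * (R - 1) + (Q - 1)"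
        using pos unfolding PQR by (cases R) simp_all
      with eq have "Q * q + t = Q * (R - 1) + (Q - 1)" by simp
      moreover have "(Q * c + d) div Q = c" "(Q * c + d) mod Q = d" if "d < Q" for c d
        using that by simp_all
      moreover have "Q - 1 < Q"
        using pos by simp
      ultimately show "t = Q - 1 \<and> q = R - 1"
        using that by metis
    next
      assume "t = Q - 1 \<and> q = R - 1"
      then show "Q * q + t = P - 1"
        using pos unfolding PQR by (cases R) simp_all
    qed
    ultimately have "(x + z) mod P = P - 1 \<longleftrightarrow> (x + z) mod Q = Q - 1 \<and> (x + z) div Q mod R = R - 1"
      using pos by simp
    \<comment> \<open>Low parts with sum \<open>Q - 1\<close> produce no carry.\<close>
    moreover have "(x + z) div Q = x div Q + z div Q" if "(x + z) mod Q = Q - 1"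
    proof -
      have "(x + z) div Q = x div Q + z div Q + (e + f) div Q"
        unfolding e_def f_def by (rule div_add1_eq)
      then show ?thesis
        using that low lt by simp
    qed
    ultimately show ?thesis by auto
  qed
  ultimately show ?thesis
    unfolding count using low high by auto
qed

text \<open>Since \<open>Q \<ge> 2\<close> and \<open>4 * Q \<le> P\<close>, the residues 0,
  \<open>Q - 1\<close>, \<open>Q\<close> and \<open>P - 1\<close> of \<open>x + z\<close> are
  distinct, which keeps the second and third conditions from interfering. For \<open>Q = 1\<close>
  the carried sum \<open>P + Q - 1\<close> would be a multiple of \<open>P\<close>, the situation of
  \<open>Ulam_pow2_minus_2\<close>.\<close>

lemma Ulam_zumkeller:
  fixes a m :: nat
  assumes a: "a \<ge> 1" and m: "m \<ge> 2"
  defines "P \<equiv> 2 ^ (a + m) :: nat" and "Q \<equiv> 2 ^ a"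
  shows "Ulam (P - Q - 1) =
    {(x, z). x + z = P - Q - 1 \<and> x mod (2 * Q) < Q \<or> (x + z) mod P = P - 1 \<or>
      x mod P + z mod P = P + Q - 1}"
proof -
  define y where "y = P - Q - 1"
  define R :: nat where "R = 2 ^ m"
  have "(2::nat) ^ 2 \<le> R"
    unfolding R_def by (rule power_increasing) (use m in auto)
  then have R: "R \<ge> 4" by simp
  have PQR: "P = Q * R" by (simp add: P_def Q_def R_def power_add)
  have "Q * 4 \<le> Q * R" using R by (rule mult_le_mono2)
  then have P: "4 * Q \<le> P" unfolding PQR by simp
  have "(2::nat) ^ 1 \<le> Q"
    unfolding Q_def by (rule power_increasing) (use a in auto)
  then have Q: "Q \<ge> 2" by simp
  have y_eq: "y = Q * (R - 2) + Q - 1"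
  proof -
    have "Q * (R - 2) = P - 2 * Q" unfolding PQR by (simp add: diff_mult_distrib2)
    then show ?thesis using P Q unfolding y_def by linarith
  qed
  obtain T where T: "P = 2 * Q * T"
  proof
    show "P = 2 * Q * 2 ^ (m - 1)"
      using m unfolding PQR R_def by (cases m) simp_all
  qed
  define S where "S = {(x, z). x + z = y \<and> x mod (2 * Q) < Q \<or> (x + z) mod P = P - 1 \<or>
      x mod P + z mod P = P + Q - 1}"
  have "Ulam y = S"
  proof (rule Ulam_eqI)
    fix x z :: nat
    define s where "s = x + z"
    define r where "r = s mod P"
    define X where "X = x mod P"
    define Z where "Z = z mod P"
    define e where "e = x mod (2 * Q)"
    define M where "M = middle_count y x z"
    define D where "D = M - of_bool (s = y \<and> and x z = 0)"
    define nx where "nx \<longleftrightarrow> x > 0 \<and> (x - 1, z) \<in> S"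
    define nz where "nz \<longleftrightarrow> z > 0 \<and> (x, z - 1) \<in> S"
    have lt: "X < P" "Z < P" "r < P" "e < 2 * Q"
      using P Q by (simp_all add: X_def Z_def r_def e_def)
    have "r = (X + Z) mod P"
      by (simp add: r_def X_def Z_def s_def mod_add_eq)
    then have r: "r = (if X + Z < P then X + Z else X + Z - P)"
      using lt by (simp add: mod_if)
    have M1: "M = 1 \<longleftrightarrow> r = P - 1 \<or> X + Z = P + Q - 1"
      unfolding M_def y_eq r_def s_def X_def Z_def unfolding P_def Q_def R_def
      by (rule middle_count_two_blocks_eq_1_iff[OF m])
    have M0: "M > 0" if "X = 0 \<or> Z = 0"
      using that P Q unfolding M_def X_def Z_def
      by (intro middle_count_pos_if_mod[where n = "a + m"]) (auto simp: y_def P_def)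
    have D_eq: "D = M" if "s \<noteq> y"
      using that by (simp add: D_def)
    have mem: "(x, z) \<in> S \<longleftrightarrow> s = y \<and> e < Q \<or> r = P - 1 \<or> X + Z = P + Q - 1"
      by (simp add: S_def s_def r_def X_def Z_def e_def)
    have shift: "(s - 1) mod P = P - 1 \<longleftrightarrow> r = 0" "s - 1 = y \<longleftrightarrow> s = y + 1" if "s > 0"
      using that P Q diff_1_mod_eq_iff[of s P] by (auto simp: r_def)
    \<comment> \<open>If \<open>X = 0\<close>, the predecessor has residue \<open>P - 1\<close>, and
      the carried sum \<open>P + Q - 1\<close> is reached exactly for \<open>Z = Q\<close>.\<close>
    have nx: "nx \<longleftrightarrow> x > 0 \<and> (s = y + 1 \<and> (1 \<le> e \<and> e \<le> Q) \<or> r = 0 \<or>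
        (if X = 0 then Z = Q else X + Z = P + Q))"
    proof (cases "x > 0")
      case True
      have s: "x - 1 + z = s - 1" "s > 0"
        using True by (simp_all add: s_def)
      have "(x - 1) mod (2 * Q) = (if e = 0 then 2 * Q - 1 else e - 1)"
        "(x - 1) mod P = (if X = 0 then P - 1 else X - 1)"
        using True P Q unfolding e_def X_def by (intro diff_1_mod; simp)+
      then have "(x - 1) mod (2 * Q) < Q \<longleftrightarrow> 1 \<le> e \<and> e \<le> Q"
        "(x - 1) mod P + Z = P + Q - 1 \<longleftrightarrow> (if X = 0 then Z = Q else X + Z = P + Q)"
        using P Q by auto
      then show ?thesis
        using True unfolding nx_def S_def mem_Collect_eq prod.case Z_def s(1) shift[OF s(2)]
        by (simp only: simp_thms)
    qed (simp add: nx_def)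
    have nz: "nz \<longleftrightarrow> z > 0 \<and> (s = y + 1 \<and> e < Q \<or> r = 0 \<or>
        (if Z = 0 then X = Q else X + Z = P + Q))"
    proof (cases "z > 0")
      case True
      have s: "x + (z - 1) = s - 1" "s > 0"
        using True by (simp_all add: s_def)
      have "(z - 1) mod P = (if Z = 0 then P - 1 else Z - 1)"
        using True P Q unfolding Z_def by (intro diff_1_mod; simp)
      then have "X + (z - 1) mod P = P + Q - 1 \<longleftrightarrow> (if Z = 0 then X = Q else X + Z = P + Q)"
        using P Q by auto
      then show ?thesis
        using True unfolding nz_def S_def mem_Collect_eq prod.case X_def e_def s(1) shift[OF s(2)]
        by (simp only: simp_thms)
    qed (simp add: nz_def)
    have small: "r = s" "X = x" "Z = z" if "s < P"
      using that by (simp_all add: r_def X_def Z_def s_def)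
    consider (a) "s = y" | (b) "s = y + 1" | (c) "s \<noteq> y" "s \<noteq> y + 1" "r = P - 1"
      | (d) "s \<noteq> y" "s \<noteq> y + 1" "X + Z = P + Q - 1"
      | (e) "s \<noteq> y" "s \<noteq> y + 1" "r = 0"
      | (f) "s \<noteq> y" "s \<noteq> y + 1" "r \<noteq> 0" "r \<noteq> P - 1" "X + Z \<noteq> P + Q - 1"
      by blast
    then have "(x, z) \<in> S \<longleftrightarrow> of_bool nx + of_bool nz + D = (1 :: nat)"
    proof cases
      case a
      have "s < P" using a P Q by (simp add: y_def)
      note small = small[OF this]
      have no: "r \<noteq> 0" "r \<noteq> P - 1" "X + Z \<noteq> P + Q - 1" "X + Z \<noteq> P + Q"
        "\<not> (X = 0 \<and> Z = Q)" "\<not> (Z = 0 \<and> X = Q)"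
        using a P Q unfolding small y_def s_def by linarith+
      then have "\<not> nx" "\<not> nz"
        unfolding nx nz using a by auto
      \<comment> \<open>\<open>e < Q\<close> says that digit \<open>a\<close> of \<open>x\<close> is
        0, the parity criterion of \<open>middle_count_diag_eq_1_iff\<close> for the upper
        part.\<close>
      moreover have "D = 1 \<longleftrightarrow> e < Q"
      proof -
        have sum: "x + z = 2 ^ a * (2 ^ m - 2) + 2 ^ a - 1"
          using a unfolding s_def y_eq Q_def R_def .
        note block = add_eq_pow2_block_iff[OF sum]
        have "s mod Q = Q - 1"
        proof -
          have "s = Q * (R - 2) + (Q - 1)"
            using Q unfolding a y_eq by simp
          then show ?thesis
            using Q by (simp only: mod_mult_self4) simp
        qed
        then have "middle_count (2 ^ a - 1) x z = 1"
          unfolding middle_count_pow2_minus_1_eq_1_iff s_def Q_def .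
        then have "M = middle_count (2 ^ m - 2) (x div 2 ^ a) (z div 2 ^ a)"
          unfolding M_def y_eq unfolding Q_def R_def middle_count_block by simp
        moreover have "D = M - of_bool (and (x div 2 ^ a) (z div 2 ^ a) = 0)"
          unfolding D_def block(1) using a by simp
        ultimately have "D = 1 \<longleftrightarrow> even (x div Q)"
          using middle_count_diag_eq_1_iff[OF m block(2)] unfolding Q_def by simp
        moreover have "e = Q * (x div Q mod 2) + x mod Q"
          unfolding e_def mult.commute[of 2 Q] by (rule mod_mult2_eq)
        moreover have "x mod Q < Q" using Q by simp
        ultimately show ?thesis
          unfolding mod_2_eq_odd by (cases "even (x div Q)") simp_all
      qed
      ultimately show ?thesis
        unfolding mem using a no by simp
    next
      case b
      have sP: "s = P - Q" using b P Q by (simp add: y_def)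
      then have "s < P" using P Q by simp
      note small = small[OF this]
      have no: "r \<noteq> 0" "r \<noteq> P - 1" "X + Z \<noteq> P + Q - 1" "X + Z \<noteq> P + Q"
        "\<not> (X = 0 \<and> Z = Q)" "\<not> (Z = 0 \<and> X = Q)"
        using sP P Q unfolding small s_def by linarith+
      have n: "nx \<longleftrightarrow> x > 0 \<and> 1 \<le> e \<and> e \<le> Q" "nz \<longleftrightarrow> z > 0 \<and> e < Q"
        unfolding nx nz using b no by auto
      have D: "D = M" "M \<noteq> 1" using D_eq M1 b no by simp_all
      have notin: "(x, z) \<notin> S" unfolding mem using b no by simp
      \<comment> \<open>For \<open>e = 0\<close> or \<open>e = Q\<close> just one neighbour can be
        in \<open>S\<close>. Then \<open>Q\<close> divides \<open>x\<close>, so the lower factor is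
        positive, and the quotients add up to \<open>R - 1\<close>, so the upper factor is
        1.\<close>
      have M: "M > 0" if "e = 0 \<or> e = Q"
      proof -
        have x: "x mod Q = 0"
        proof -
          have "x mod Q = e mod Q" unfolding e_def by (simp add: mod_mod_cancel)
          then show ?thesis using that by auto
        qed
        have "middle_count (Q - 1) x z > 0"
          using x Q by (intro middle_count_pos_if_mod[where n = a]) (auto simp: Q_def)
        moreover have "middle_count (R - 2) (x div Q) (z div Q) = 1"
        proof -
          have "s div Q = x div Q + z div Q"
            unfolding s_def using x by (simp add: div_add1_eq)
          moreover have "s = Q * (R - 1)"
            unfolding sP PQR by (simp add: diff_mult_distrib2)
          ultimately have "x div Q + z div Q = R - 1" using Q by simp
          then show ?thesis
            using middle_count_pow2_minus_2_eq_1_iff[OF m, of "x div Q" "z div Q"] R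
            unfolding R_def by simp
        qed
        ultimately show ?thesis
          unfolding M_def y_eq unfolding Q_def R_def middle_count_block by simp
      qed
      \<comment> \<open>\<open>P\<close> is a multiple of \<open>2 * Q\<close>, so
        \<open>x = P - Q\<close> leaves residue \<open>Q\<close>.\<close>
      have e_z: "e = Q" if "z = 0"
      proof -
        have "x = Q + 2 * Q * (T - 1)"
        proof -
          have "T > 0" using T P Q by (cases T) auto
          then have "2 * Q * T = 2 * Q * (T - 1) + 2 * Q" by (cases T) simp_all
          then show ?thesis using that sP T unfolding s_def by simp
        qed
        then show ?thesis unfolding e_def using Q by simp
      qed
      have M_0: "M > 0" if "x = 0 \<or> z = 0"
        using M0 that by (auto simp: X_def Z_def)
      consider "x = 0" "e = 0" "z > 0" | "z = 0" "e = Q" "x > 0" | "x > 0" "z > 0"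
        using sP P Q e_z unfolding s_def e_def by (cases "x = 0"; cases "z = 0") auto
      then show ?thesis
      proof cases
        case 1
        then show ?thesis using n D notin M_0 Q by simp
      next
        case 2
        then show ?thesis using n D notin M_0 Q by simp
      next
        case 3
        \<comment> \<open>In this order the neighbours in \<open>S\<close> are: only the one with
          \<open>z - 1\<close>, only the one with \<open>x - 1\<close>, both, none.\<close>
        consider "e = 0" | "e = Q" | "1 \<le> e" "e < Q" | "e > Q" by linarith
        then show ?thesis
          by cases (use 3 n D notin M Q in auto)
      qed
    next
      case c
      have "\<not> nx" "\<not> nz"
        unfolding nx nz using c r lt P Q by (auto split: if_splits)
      moreover have "D = 1" using c D_eq M1 by simp
      ultimately show ?thesis unfolding mem using c by simp
    next
      case d
      have "r = Q - 1" using d r P Q by simp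
      then have "\<not> nx" "\<not> nz"
        unfolding nx nz using d lt P Q by (auto split: if_splits)
      moreover have "D = 1" using d D_eq M1 by simp
      ultimately show ?thesis unfolding mem using d by simp
    next
      case e
      have "r = Q - 1" if "X + Z = P + Q - 1"
        using that r P Q by simp
      then have "X + Z \<noteq> P + Q - 1" using e Q by auto
      then have notin: "(x, z) \<notin> S" "M \<noteq> 1"
        unfolding mem M1 using e P Q by auto
      have "nx \<longleftrightarrow> x > 0" "nz \<longleftrightarrow> z > 0" unfolding nx nz using e by auto
      moreover have "M > 0" if "x = 0 \<or> z = 0"
        using M0 that by (auto simp: X_def Z_def)
      ultimately show ?thesis
        using notin D_eq[OF e(1)] by (cases "x = 0"; cases "z = 0") auto
    next
      case f
      have notin: "(x, z) \<notin> S" "M \<noteq> 1" "D = M"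
        unfolding mem M1 using f D_eq by auto
      have n: "nx \<longleftrightarrow> x > 0 \<and> (if X = 0 then Z = Q else X + Z = P + Q)"
        "nz \<longleftrightarrow> z > 0 \<and> (if Z = 0 then X = Q else X + Z = P + Q)"
        unfolding nx nz using f by auto
      have pos: "X > 0 \<Longrightarrow> x > 0" "Z > 0 \<Longrightarrow> z > 0"
        unfolding X_def Z_def by (auto intro: Nat.gr0I)
      \<comment> \<open>For \<open>X + Z = P + Q\<close> both neighbours carry to
        \<open>P + Q - 1\<close>. With a residue 0 at most one neighbour remains, and the count is
        positive.\<close>
      consider "X + Z = P + Q" | "X = 0" | "Z = 0" | "X > 0" "Z > 0" "X + Z \<noteq> P + Q"
        by blast
      then show ?thesis
      proof cases
        case 1
        then have "X > 0" "Z > 0" using lt Q by auto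
        then have "nx" "nz" using n pos 1 by auto
        then show ?thesis using notin by simp
      next
        case 2
        then show ?thesis using notin n M0 lt by auto
      next
        case 3
        then show ?thesis using notin n M0 lt by auto
      next
        case 4
        then show ?thesis using notin n by auto
      qed
    qed
    then show "((x, z) \<in> S) = (of_bool (x > 0 \<and> (x - 1, z) \<in> S) + of_bool (z > 0 \<and> (x, z - 1) \<in> S) +
        (middle_count y x z - of_bool (x + z = y \<and> and x z = 0)) = (1 :: nat))"
      unfolding nx_def nz_def D_def M_def s_def .
  qed
  then show ?thesis unfolding S_def y_def .
qed

text \<open>\<open>2 ^ (k + 1) - 1\<close> has ones at all positions up to \<open>k\<close>, and
  subtracting \<open>2 ^ a\<close> erases one of them.\<close>

lemma zumkeller_pow2_diff:
  assumes "0 < a" "a < k"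
  shows "zumkeller (2 ^ (k + 1) - 2 ^ a - 1)"
proof -
  define y :: nat where "y = 2 ^ (k + 1) - 2 ^ a - 1"
  have less: "(2::nat) ^ a < 2 ^ k"
    using assms by simp
  moreover have "(2::nat) ^ (k + 1) = 2 * 2 ^ k" by simp
  ultimately have "y > 0"
    unfolding y_def by linarith
  have bitI: "bit (2 ^ i * (2 * w + 1) + c) i" if "c < 2 ^ i" for i w c :: nat
  proof -
    have "(2 ^ i * n + c) div 2 ^ i = n" for n
      using that by simp
    then show ?thesis
      by (simp only: bit_iff_odd) simp
  qed
  have "i = a" if "2 ^ i \<le> y" "\<not> bit y i" for i
  proof (rule ccontr)
    assume "i \<noteq> a"
    have "(2::nat) ^ i < 2 ^ (k + 1)"
      using that(1) \<open>y > 0\<close> unfolding y_def by linarith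
    then have "i < k + 1"
      by (rule power_less_imp_less_exp[rotated]) simp
    then have "i \<le> k" by simp
    have "bit y i"
    proof (cases "i < a")
      case True
      then obtain d where d: "a = i + Suc d"
        using less_iff_Suc_add by auto
      obtain d' where d': "k = a + Suc d'"
        using assms(2) less_iff_Suc_add by auto
      have "(2::nat) ^ d \<ge> 1" "(2::nat) ^ i \<ge> 1" "(2::nat) ^ (d + Suc d') \<ge> 2 ^ d * 2"
        by (simp_all add: power_add)
      \<comment> \<open>Below \<open>a\<close> the number is \<open>2 ^ (i + 1)\<close> times
        \<open>w + 1\<close>, minus 1, so it ends in \<open>i + 1\<close> ones.\<close>
      define w :: nat where "w = 2 ^ Suc (d + Suc d') - 2 ^ d - 1"
      have w: "w + 1 + 2 ^ d = 2 ^ Suc (d + Suc d')"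
        using \<open>(2::nat) ^ d \<ge> 1\<close> \<open>(2::nat) ^ (d + Suc d') \<ge> 2 ^ d * 2\<close> unfolding w_def power_Suc by linarith
      have "2 ^ (k + 1) = 2 ^ i * 2 * (w + 1 + 2 ^ d)"
        unfolding w by (simp add: d d' power_add)
      moreover have "(2::nat) ^ a = 2 ^ i * 2 * 2 ^ d"
        by (simp add: d power_add)
      ultimately have "y = 2 ^ i * 2 * (w + 1) - 1"
        unfolding y_def by (simp add: algebra_simps)
      also have "\<dots> = 2 ^ i * (2 * w + 1) + (2 ^ i - 1)"
        using \<open>(2::nat) ^ i \<ge> 1\<close> by (simp add: algebra_simps)
      finally show ?thesis
        using bitI[of "2 ^ i - 1" i w] by simp
    next
      case False
      with \<open>i \<noteq> a\<close> have "a < i" by simp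
      then have "(2::nat) ^ a < 2 ^ i" by simp
      \<comment> \<open>Above \<open>a\<close> the subtracted \<open>2 ^ a + 1\<close> is at most
        \<open>2 ^ i\<close>, so the odd quotient \<open>2 * w + 1\<close> is preserved.\<close>
      define w :: nat where "w = 2 ^ (k - i) - 1"
      have "2 ^ (k + 1) = 2 ^ i * (2 * w + 1) + (2::nat) ^ i"
      proof -
        have "2 * w + 1 + 1 = 2 * 2 ^ (k - i)"
          unfolding w_def using one_le_power[of "2::nat" "k - i"] by linarith
        then have "2 ^ i * (2 * w + 1) + (2::nat) ^ i = 2 ^ i * (2 * 2 ^ (k - i))"
          by (metis distrib_left mult.right_neutral)
        also have "\<dots> = 2 ^ (i + (k - i) + 1)"
          by (simp add: power_add)
        finally show ?thesis using \<open>i \<le> k\<close> by simp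
      qed
      then have "y = 2 ^ i * (2 * w + 1) + (2 ^ i - 2 ^ a - 1)"
        using \<open>(2::nat) ^ a < 2 ^ i\<close> unfolding y_def by linarith
      then show ?thesis
        using bitI[of "2 ^ i - 2 ^ a - 1" i w] by simp
    qed
    with that(2) show False by simp
  qed
  then have "{i. 2 ^ i \<le> y \<and> \<not> bit y i} \<subseteq> {a}" by auto
  then have "card {i. 2 ^ i \<le> y \<and> \<not> bit y i} \<le> card {a}"
    by (intro card_mono) simp_all
  with \<open>y > 0\<close> show ?thesis
    unfolding zumkeller_def y_def by simp
qed

theorem theorem1p9:
  shows "(\<forall>k::nat. Ulam (2 ^ (k + 1) - 1) =
            {(x, z). [int (x + z) = -1] (mod 2 ^ (k + 1)) \<and> x + z \<noteq> 2 ^ (k + 1) - 1}) \<and>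
         (\<forall>k::nat. k \<ge> 1 \<longrightarrow> Ulam (2 ^ (k + 1) - 2) =
            {(x, z). ([int (x + z) = -1] (mod 2 ^ (k + 1)) \<and> x + z \<noteq> 2 ^ (k + 1) - 1) \<or>
                     (x + z = 2 ^ (k + 1) - 2 \<and> [x = 0] (mod 2) \<and> [z = 0] (mod 2)) \<or>
                     (x + z = 2 ^ (k + 1) \<and> x > 0 \<and> z > 0)}) \<and>
         (\<forall>(k::nat) (a::nat) (y::nat). 0 < a \<and> a < k \<and> y = 2 ^ (k + 1) - 2 ^ a - 1 \<longrightarrow>
            zumkeller y \<and>
            Ulam y =
            {(x, z). (x + z = y \<and> x mod 2 ^ (a + 1) < 2 ^ a) \<or>
                     [int (x + z) = -1] (mod 2 ^ (k + 1)) \<or>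
                     x mod 2 ^ (k + 1) + z mod 2 ^ (k + 1) = 2 ^ (k + 1) + 2 ^ a - 1})"
proof (intro conjI allI impI)
  fix k :: nat
  show "Ulam (2 ^ (k + 1) - 1) =
      {(x, z). [int (x + z) = -1] (mod 2 ^ (k + 1)) \<and> x + z \<noteq> 2 ^ (k + 1) - 1}"
    unfolding cong_minus_1_iff using Ulam_pow2_minus_1[of k] by simp
next
  fix k :: nat
  assume "k \<ge> 1"
  have even: "[n = 0] (mod 2) \<longleftrightarrow> even n" for n :: nat
    by (rule cong_0_iff)
  show "Ulam (2 ^ (k + 1) - 2) =
      {(x, z). ([int (x + z) = -1] (mod 2 ^ (k + 1)) \<and> x + z \<noteq> 2 ^ (k + 1) - 1) \<or>
               (x + z = 2 ^ (k + 1) - 2 \<and> [x = 0] (mod 2) \<and> [z = 0] (mod 2)) \<or>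
               (x + z = 2 ^ (k + 1) \<and> x > 0 \<and> z > 0)}"
    unfolding cong_minus_1_iff even by (rule Ulam_pow2_minus_2) (use \<open>k \<ge> 1\<close> in simp)
next
  fix k a y :: nat
  assume "0 < a \<and> a < k \<and> y = 2 ^ (k + 1) - 2 ^ a - 1"
  then have a: "0 < a" "a < k" and y: "y = 2 ^ (k + 1) - 2 ^ a - 1" by auto
  show "zumkeller y"
    unfolding y using a by (rule zumkeller_pow2_diff)
  \<comment> \<open>\<open>k + 1 - a\<close> counts the digits from the zero upwards;
    \<open>a < k\<close> makes it at least 2.\<close>
  have k: "a + (k + 1 - a) = k + 1" "2 ^ (a + 1) = 2 * (2::nat) ^ a"
    using a by simp_all
  show "Ulam y =
      {(x, z). (x + z = y \<and> x mod 2 ^ (a + 1) < 2 ^ a) \<or>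
               [int (x + z) = -1] (mod 2 ^ (k + 1)) \<or>
               x mod 2 ^ (k + 1) + z mod 2 ^ (k + 1) = 2 ^ (k + 1) + 2 ^ a - 1}"
    using Ulam_zumkeller[of a "k + 1 - a"] a unfolding y cong_minus_1_iff k by simp
qed

end
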